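(* Let $A$ be a finite alphabet and $(\mathbb{M},\otimes,\mathbf{1})$ a monoid. For all positive integers $k$, a relation $R\subseteq A^*\times\mathbb{M}$ is $k$-sequential if and only if it is computed by a cost register automaton over $\mathbb{M}$ with $k$ independent registers.
   Context: A weighted automaton on $A$ over $\mathbb{M}$ is a tuple $W=(Q,t_{init},t_{final},T)$ with $Q$ a finite set of states, $t_{init},t_{final}\subseteq Q\times\mathbb{M}$ finite, and $T\subseteq Q\times A\times\mathbb{M}\times Q$ finite. A run $p\xrightarrow{w|\alpha}q$ is a sequence of consecutive transitions from $p$ to $q$ reading $w$, with output $\alpha$ the product of the weights in order. $W$ computes $[\![W]\!]=\{(w,\alpha\beta\gamma) : \exists p,q,\ (p,\alpha)\in t_{init},\ p\xrightarrow{w|\beta}q,\ (q,\gamma)\in t_{final}\}$. $W$ is sequential if $|t_{init}|=1$ and for all $p\in Q,a\in A$ there is at most one transition of the form $(p,a,\alpha,q)$ in $T$. $W$ is $k$-sequential if it is a disjoint union of $k$ sequential weighted automata; a relation is $k$-sequential if it is computed by a $k$-sequential weighted automaton. A cost register automaton on $A$ over $\mathbb{M}$ is a tuple $(Q,q_{init},\mathcal{X},\delta,\mu)$ where $Q$ is a finite set of states, $q_{init}\in Q$, $\mathcal{X}$ is a finite set of registers, $\delta:Q\times A\to Q\times\mathcal{UP}(\mathcal{X})$ with $\mathcal{UP}(\mathcal{X})$ the set of (update) functions $\mathcal{X}\to\mathcal{X}\times\mathbb{M}$, and $\mu\subseteq Q\times\mathcal{X}\times\mathbb{M}$ is finite (output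 relation). A valuation is a map $\nu:\mathcal{X}\to\mathbb{M}$; the initial valuation is constantly $\mathbf{1}$. A run on $w=w_1\cdots w_n$ is a sequence of configurations $(q_1,\nu_1)\dots(q_{n+1},\nu_{n+1})$ such that for each $i\le n$, $\delta(q_i,w_i)=(q_{i+1},g_i)$ and, for every register $Y$ with $g_i(Y)=(X,\alpha)$, $\nu_{i+1}(Y)=\nu_i(X)\alpha$. The automaton computes the set of pairs $(w,\nu_{n+1}(X)\alpha)$ such that the run on $w$ from $(q_{init},\nu_{init})$ ends in $(q_{n+1},\nu_{n+1})$ and $(q_{n+1},X,\alpha)\in\mu$. It has independent registers if every update function $f$ labelling a transition satisfies: $f(Y)=(X,\alpha)$ implies $X=Y$. "With $k$ independent registers" means independent registers and $|\mathcal{X}|=k$. *)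

theory Defs
  imports Main
begin

record ('q, 'a, 'm) wa =
  wa_states :: "'q set"
  wa_init :: "('q \<times> 'm) set"
  wa_final :: "('q \<times> 'm) set"
  wa_trans :: "('q \<times> 'a \<times> 'm \<times> 'q) set"

definition weighted_automaton :: "'a set \<Rightarrow> ('q, 'a, 'm) wa \<Rightarrow> bool" where
  "weighted_automaton A W \<longleftrightarrow>
     finite (wa_states W) \<and>
     finite (wa_init W) \<and> wa_init W \<subseteq> wa_states W \<times> UNIV \<and>
     finite (wa_final W) \<and> wa_final W \<subseteq> wa_states W \<times> UNIV \<and>
     finite (wa_trans W) \<and> wa_trans W \<subseteq> wa_states W \<times> A \<times> UNIV \<times> wa_states W"

inductive wa_run :: "('q, 'a, 'm::monoid_mult) wa \<Rightarrow> 'q \<Rightarrow> 'a list \<Rightarrow> 'm \<Rightarrow> 'q \<Rightarrow> bool"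
  for W where
  wa_run_Nil: "p \<in> wa_states W \<Longrightarrow> wa_run W p [] 1 p"
| wa_run_Cons: "(p, a, \<alpha>, r) \<in> wa_trans W \<Longrightarrow> wa_run W r w \<beta> q \<Longrightarrow> wa_run W p (a # w) (\<alpha> * \<beta>) q"

definition wa_relation :: "('q, 'a, 'm::monoid_mult) wa \<Rightarrow> ('a list \<times> 'm) set" where
  "wa_relation W =
     {(w, \<alpha> * \<beta> * \<gamma>) | w \<alpha> \<beta> \<gamma>.
        \<exists>p q. (p, \<alpha>) \<in> wa_init W \<and> wa_run W p w \<beta> q \<and> (q, \<gamma>) \<in> wa_final W}"

definition sequential_wa :: "'a set \<Rightarrow> ('q, 'a, 'm) wa \<Rightarrow> bool" where
  "sequential_wa A W \<longleftrightarrow>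
     weighted_automaton A W \<and>
     card (wa_init W) = 1 \<and>
     (\<forall>p \<alpha> q a \<alpha>' q'. (p, a, \<alpha>, q) \<in> wa_trans W \<longrightarrow> (p, a, \<alpha>', q') \<in> wa_trans W
        \<longrightarrow> \<alpha> = \<alpha>' \<and> q = q')"

definition wa_disjoint_union :: "nat \<Rightarrow> (nat \<Rightarrow> ('q, 'a, 'm) wa) \<Rightarrow> ('q, 'a, 'm) wa \<Rightarrow> bool" where
  "wa_disjoint_union k Ws W \<longleftrightarrow>
     (\<forall>i<k. \<forall>j<k. i \<noteq> j \<longrightarrow> wa_states (Ws i) \<inter> wa_states (Ws j) = {}) \<and>
     wa_states W = (\<Union>i<k. wa_states (Ws i)) \<and>
     wa_init W = (\<Union>i<k. wa_init (Ws i)) \<and>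
     wa_final W = (\<Union>i<k. wa_final (Ws i)) \<and>
     wa_trans W = (\<Union>i<k. wa_trans (Ws i))"

definition k_sequential_wa :: "'a set \<Rightarrow> nat \<Rightarrow> ('q, 'a, 'm) wa \<Rightarrow> bool" where
  "k_sequential_wa A k W \<longleftrightarrow>
     (\<exists>Ws. (\<forall>i<k. sequential_wa A (Ws i)) \<and> wa_disjoint_union k Ws W)"

text \<open>
  A definition cannot quantify over the type of states, so natural numbers are used as states
  (and, below, as registers). State and register sets being finite, this is no restriction: see
  the lemmas \<open>k_sequential_relationI\<close> and \<open>independent_cra_relationI\<close>.
\<close>

definition k_sequential_relation :: "'a set \<Rightarrow> nat \<Rightarrow> ('a list \<times> 'm::monoid_mult) set \<Rightarrow> bool" where
  "k_sequential_relation A k R \<longleftrightarrow>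
     (\<exists>W :: (nat, 'a, 'm) wa. k_sequential_wa A k W \<and> wa_relation W = R)"

text \<open>
  Valuations and update functions are total HOL functions; only their values on
  \<open>cra_registers\<close> matter.
\<close>

record ('q, 'x, 'a, 'm) cra =
  cra_states :: "'q set"
  cra_init :: 'q
  cra_registers :: "'x set"
  cra_delta :: "'q \<Rightarrow> 'a \<Rightarrow> 'q \<times> ('x \<Rightarrow> 'x \<times> 'm)"
  cra_out :: "('q \<times> 'x \<times> 'm) set"

definition cost_register_automaton :: "'a set \<Rightarrow> ('q, 'x, 'a, 'm) cra \<Rightarrow> bool" where
  "cost_register_automaton A C \<longleftrightarrow>
     finite (cra_states C) \<and>
     cra_init C \<in> cra_states C \<and>
     finite (cra_registers C) \<and>
     (\<forall>q\<in>cra_states C. \<forall>a\<in>A.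
        fst (cra_delta C q a) \<in> cra_states C \<and>
        snd (cra_delta C q a) ` cra_registers C \<subseteq> cra_registers C \<times> UNIV) \<and>
     finite (cra_out C) \<and> cra_out C \<subseteq> cra_states C \<times> cra_registers C \<times> UNIV"

definition cra_step ::
  "('q, 'x, 'a, 'm::monoid_mult) cra \<Rightarrow> 'q \<times> ('x \<Rightarrow> 'm) \<Rightarrow> 'a \<Rightarrow> 'q \<times> ('x \<Rightarrow> 'm) \<Rightarrow> bool" where
  "cra_step C c a c' \<longleftrightarrow>
     (\<exists>g. cra_delta C (fst c) a = (fst c', g) \<and>
        (\<forall>Y\<in>cra_registers C. \<forall>X \<alpha>. g Y = (X, \<alpha>) \<longrightarrow> snd c' Y = snd c X * \<alpha>))"

definition cra_run ::
  "('q, 'x, 'a, 'm::monoid_mult) cra \<Rightarrow> 'a list \<Rightarrow> ('q \<times> ('x \<Rightarrow> 'm)) list \<Rightarrow> bool" where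
  "cra_run C w cs \<longleftrightarrow>
     length cs = Suc (length w) \<and> (\<forall>i<length w. cra_step C (cs ! i) (w ! i) (cs ! Suc i))"

definition cra_relation :: "'a set \<Rightarrow> ('q, 'x, 'a, 'm::monoid_mult) cra \<Rightarrow> ('a list \<times> 'm) set" where
  "cra_relation A C =
     {(w, \<nu> X * \<alpha>) | w \<nu> X \<alpha>.
        w \<in> lists A \<and>
        (\<exists>cs q. cra_run C w cs \<and> hd cs = (cra_init C, \<lambda>_. 1) \<and> last cs = (q, \<nu>) \<and>
           (q, X, \<alpha>) \<in> cra_out C)}"

definition independent_registers :: "'a set \<Rightarrow> ('q, 'x, 'a, 'm) cra \<Rightarrow> bool" where
  "independent_registers A C \<longleftrightarrow>
     (\<forall>q\<in>cra_states C. \<forall>a\<in>A. \<forall>Y\<in>cra_registers C. \<forall>X \<alpha>.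
        snd (cra_delta C q a) Y = (X, \<alpha>) \<longrightarrow> X = Y)"

definition independent_cra_relation ::
  "'a set \<Rightarrow> nat \<Rightarrow> ('a list \<times> 'm::monoid_mult) set \<Rightarrow> bool" where
  "independent_cra_relation A k R \<longleftrightarrow>
     (\<exists>C :: (nat, nat, 'a, 'm) cra.
        cost_register_automaton A C \<and> independent_registers A C \<and>
        card (cra_registers C) = k \<and> cra_relation A C = R)"


definition map_wa :: "('q \<Rightarrow> 'r) \<Rightarrow> ('q, 'a, 'm) wa \<Rightarrow> ('r, 'a, 'm) wa" where
  "map_wa f W = \<lparr>wa_states = f ` wa_states W,
     wa_init = (\<lambda>(p, \<alpha>). (f p, \<alpha>)) ` wa_init W,
     wa_final = (\<lambda>(p, \<alpha>). (f p, \<alpha>)) ` wa_final W,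
     wa_trans = (\<lambda>(p, a, \<alpha>, q). (f p, a, \<alpha>, f q)) ` wa_trans W\<rparr>"

lemma map_wa_simps:
  "wa_states (map_wa f W) = f ` wa_states W"
  "wa_init (map_wa f W) = (\<lambda>(p, \<alpha>). (f p, \<alpha>)) ` wa_init W"
  "wa_final (map_wa f W) = (\<lambda>(p, \<alpha>). (f p, \<alpha>)) ` wa_final W"
  "wa_trans (map_wa f W) = (\<lambda>(p, a, \<alpha>, q). (f p, a, \<alpha>, f q)) ` wa_trans W"
  by (simp_all add: map_wa_def)

lemma wa_run_map_wa:
  "wa_run W p w \<beta> q \<Longrightarrow> wa_run (map_wa f W) (f p) w \<beta> (f q)"
proof (induction rule: wa_run.induct)
  case (wa_run_Nil p)
  then show ?case by (auto intro!: wa_run.wa_run_Nil simp: map_wa_simps)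
next
  case (wa_run_Cons p a \<alpha> r w \<beta> q)
  have "(f p, a, \<alpha>, f r) \<in> wa_trans (map_wa f W)"
    using wa_run_Cons(1) by (force simp: map_wa_simps)
  then show ?case using wa_run_Cons by (auto intro: wa_run.wa_run_Cons)
qed

lemma wa_run_map_waD:
  assumes "weighted_automaton A W" and "inj_on f (wa_states W)"
  shows "wa_run (map_wa f W) p' w \<beta> q' \<Longrightarrow>
    \<exists>p q. p \<in> wa_states W \<and> q \<in> wa_states W \<and> p' = f p \<and> q' = f q \<and> wa_run W p w \<beta> q"
proof (induction rule: wa_run.induct)
  case (wa_run_Nil p)
  then show ?case by (auto intro: wa_run.wa_run_Nil simp: map_wa_simps)
next
  case (wa_run_Cons p' a \<alpha> r' w \<beta> q')
  obtain r q where rq: "r \<in> wa_states W" "q \<in> wa_states W" "r' = f r" "q' = f q" "wa_run W r w \<beta> q"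
    using wa_run_Cons by blast
  obtain p s where ps: "p' = f p" "r' = f s" "(p, a, \<alpha>, s) \<in> wa_trans W"
    using wa_run_Cons(1) by (auto simp: map_wa_simps)
  have "p \<in> wa_states W" "s \<in> wa_states W"
    using ps(3) assms(1) by (auto simp: weighted_automaton_def)
  moreover have "s = r" using assms(2) rq ps \<open>s \<in> wa_states W\<close> by (auto dest: inj_onD)
  ultimately show ?case using ps rq by (blast intro: wa_run.wa_run_Cons)
qed

lemma wa_relationI:
  "(p, \<alpha>) \<in> wa_init W \<Longrightarrow> wa_run W p w \<beta> q \<Longrightarrow> (q, \<gamma>) \<in> wa_final W
    \<Longrightarrow> (w, \<alpha> * \<beta> * \<gamma>) \<in> wa_relation W"
  unfolding wa_relation_def by blast

lemma wa_relation_map_wa: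
  assumes "weighted_automaton A W" and "inj_on f (wa_states W)"
  shows "wa_relation (map_wa f W) = wa_relation W"
proof (intro set_eqI iffI)
  fix x assume "x \<in> wa_relation (map_wa f W)"
  then obtain w \<alpha> \<beta> \<gamma> p' q' where x: "x = (w, \<alpha> * \<beta> * \<gamma>)"
    and h: "(p', \<alpha>) \<in> wa_init (map_wa f W)" "wa_run (map_wa f W) p' w \<beta> q'"
      "(q', \<gamma>) \<in> wa_final (map_wa f W)"
    unfolding wa_relation_def by blast
  obtain p q where pq: "p \<in> wa_states W" "q \<in> wa_states W" "p' = f p" "q' = f q" "wa_run W p w \<beta> q"
    using wa_run_map_waD[OF assms h(2)] by blast
  obtain p1 where p1: "f p1 = p'" "(p1, \<alpha>) \<in> wa_init W" using h(1) by (auto simp: map_wa_simps)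
  obtain q1 where q1: "f q1 = q'" "(q1, \<gamma>) \<in> wa_final W" using h(3) by (auto simp: map_wa_simps)
  have "p1 \<in> wa_states W" "q1 \<in> wa_states W"
    using p1 q1 assms(1) by (auto simp: weighted_automaton_def)
  then have "p1 = p" "q1 = q" using pq p1 q1 assms(2) by (auto dest: inj_onD)
  then show "x \<in> wa_relation W" using pq p1 q1 x by (auto intro: wa_relationI)
next
  fix x assume "x \<in> wa_relation W"
  then obtain w \<alpha> \<beta> \<gamma> p q where x: "x = (w, \<alpha> * \<beta> * \<gamma>)"
    and h: "(p, \<alpha>) \<in> wa_init W" "wa_run W p w \<beta> q" "(q, \<gamma>) \<in> wa_final W"
    unfolding wa_relation_def by blast
  have "(f p, \<alpha>) \<in> wa_init (map_wa f W)" "(f q, \<gamma>) \<in> wa_final (map_wa f W)"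
    using h by (force simp: map_wa_simps)+
  with wa_run_map_wa[OF h(2), of f] x show "x \<in> wa_relation (map_wa f W)"
    by (auto intro: wa_relationI)
qed

lemma sequential_wa_map_wa:
  assumes "sequential_wa A W" and "inj_on f (wa_states W)"
  shows "sequential_wa A (map_wa f W)"
proof -
  have W: "weighted_automaton A W" and c: "card (wa_init W) = 1"
    and det: "\<And>p \<alpha> q a \<alpha>' q'. (p, a, \<alpha>, q) \<in> wa_trans W \<Longrightarrow> (p, a, \<alpha>', q') \<in> wa_trans W
        \<Longrightarrow> \<alpha> = \<alpha>' \<and> q = q'"
    using assms(1) by (simp_all add: sequential_wa_def)
  have "weighted_automaton A (map_wa f W)"
    unfolding weighted_automaton_def map_wa_simps
  proof (intro conjI)
    show "(\<lambda>(p, a, \<alpha>, q). (f p, a, \<alpha>, f q)) ` wa_trans W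
        \<subseteq> f ` wa_states W \<times> A \<times> UNIV \<times> f ` wa_states W"
    proof (rule image_subsetI)
      fix t assume "t \<in> wa_trans W"
      then have "t \<in> wa_states W \<times> A \<times> UNIV \<times> wa_states W"
        using W unfolding weighted_automaton_def by blast
      then show "(\<lambda>(p, a, \<alpha>, q). (f p, a, \<alpha>, f q)) t
          \<in> f ` wa_states W \<times> A \<times> UNIV \<times> f ` wa_states W"
        by (auto split: prod.splits)
    qed
  qed (use W in \<open>auto simp: weighted_automaton_def\<close>)
  moreover have "card (wa_init (map_wa f W)) = 1"
    using c by (auto simp: map_wa_simps card_1_singleton_iff)
  moreover have "\<alpha> = \<alpha>' \<and> q = q'"
    if t: "(p, a, \<alpha>, q) \<in> wa_trans (map_wa f W)" "(p, a, \<alpha>', q') \<in> wa_trans (map_wa f W)"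
    for p \<alpha> q a \<alpha>' q'
  proof -
    obtain p1 q1 where 1: "p = f p1" "q = f q1" "(p1, a, \<alpha>, q1) \<in> wa_trans W"
      using t(1) by (auto simp: map_wa_simps)
    obtain p2 q2 where 2: "p = f p2" "q' = f q2" "(p2, a, \<alpha>', q2) \<in> wa_trans W"
      using t(2) by (auto simp: map_wa_simps)
    have "p1 \<in> wa_states W" "p2 \<in> wa_states W"
      using 1 2 W by (auto simp: weighted_automaton_def)
    then have "p1 = p2" using 1 2 assms(2) by (auto dest: inj_onD)
    then show ?thesis using det 1 2 by blast
  qed
  ultimately show ?thesis unfolding sequential_wa_def by blast
qed

lemma k_sequential_wa_imp_weighted_automaton:
  assumes "k_sequential_wa A k W"
  shows "weighted_automaton A W"
proof -
  obtain Ws where s: "\<And>i. i < k \<Longrightarrow> weighted_automaton A (Ws i)" and d: "wa_disjoint_union k Ws W"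
    using assms by (auto simp: k_sequential_wa_def sequential_wa_def)
  have sub: "wa_states (Ws i) \<subseteq> wa_states W" if "i < k" for i
    using d that by (auto simp: wa_disjoint_union_def)
  show ?thesis
    unfolding weighted_automaton_def
  proof (intro conjI)
    show "wa_init W \<subseteq> wa_states W \<times> UNIV"
    proof
      fix x assume "x \<in> wa_init W"
      then obtain i where "i < k" "x \<in> wa_init (Ws i)" using d by (auto simp: wa_disjoint_union_def)
      with s[OF \<open>i < k\<close>] have "x \<in> wa_states (Ws i) \<times> UNIV"
        unfolding weighted_automaton_def by blast
      with sub[OF \<open>i < k\<close>] show "x \<in> wa_states W \<times> UNIV" by (auto simp: mem_Times_iff)
    qed
    show "wa_final W \<subseteq> wa_states W \<times> UNIV"
    proof
      fix x assume "x \<in> wa_final W"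
      then obtain i where "i < k" "x \<in> wa_final (Ws i)" using d by (auto simp: wa_disjoint_union_def)
      with s[OF \<open>i < k\<close>] have "x \<in> wa_states (Ws i) \<times> UNIV"
        unfolding weighted_automaton_def by blast
      with sub[OF \<open>i < k\<close>] show "x \<in> wa_states W \<times> UNIV" by (auto simp: mem_Times_iff)
    qed
    show "wa_trans W \<subseteq> wa_states W \<times> A \<times> UNIV \<times> wa_states W"
    proof
      fix x assume "x \<in> wa_trans W"
      then obtain i where "i < k" "x \<in> wa_trans (Ws i)" using d by (auto simp: wa_disjoint_union_def)
      with s[OF \<open>i < k\<close>] have "x \<in> wa_states (Ws i) \<times> A \<times> UNIV \<times> wa_states (Ws i)"
        unfolding weighted_automaton_def by blast
      with sub[OF \<open>i < k\<close>] show "x \<in> wa_states W \<times> A \<times> UNIV \<times> wa_states W"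
        by (auto simp: mem_Times_iff)
    qed
  qed (use d s in \<open>simp_all add: weighted_automaton_def wa_disjoint_union_def\<close>)
qed

lemma k_sequential_relationI:
  fixes W :: "('q, 'a, 'm::monoid_mult) wa"
  assumes "k_sequential_wa A k W"
  shows "k_sequential_relation A k (wa_relation W)"
proof -
  have W: "weighted_automaton A W" by (rule k_sequential_wa_imp_weighted_automaton[OF assms])
  then obtain f :: "'q \<Rightarrow> nat" where f: "inj_on f (wa_states W)"
    using finite_imp_inj_to_nat_seg by (metis weighted_automaton_def)
  obtain Ws where s: "\<And>i. i < k \<Longrightarrow> sequential_wa A (Ws i)" and d: "wa_disjoint_union k Ws W"
    using assms by (auto simp: k_sequential_wa_def)
  have sub: "wa_states (Ws i) \<subseteq> wa_states W" if "i < k" for i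
    using d that by (auto simp: wa_disjoint_union_def)
  have "wa_disjoint_union k (\<lambda>i. map_wa f (Ws i)) (map_wa f W)"
    unfolding wa_disjoint_union_def map_wa_simps
  proof (intro conjI allI impI)
    fix i j assume "i < k" "j < k" "i \<noteq> j"
    then have "wa_states (Ws i) \<inter> wa_states (Ws j) = {}"
      using d by (auto simp: wa_disjoint_union_def)
    then show "f ` wa_states (Ws i) \<inter> f ` wa_states (Ws j) = {}"
      using inj_on_image_Int[OF f sub[OF \<open>i < k\<close>] sub[OF \<open>j < k\<close>]] by simp
  qed (use d in \<open>simp_all only: wa_disjoint_union_def image_UN\<close>)
  moreover have "sequential_wa A (map_wa f (Ws i))" if "i < k" for i
    using sequential_wa_map_wa s[OF that] inj_on_subset[OF f sub[OF that]] by blast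
  ultimately have "k_sequential_wa A k (map_wa f W)"
    unfolding k_sequential_wa_def by (intro exI[of _ "\<lambda>i. map_wa f (Ws i)"]) blast
  then show ?thesis
    unfolding k_sequential_relation_def using wa_relation_map_wa[OF W f] by blast
qed


definition map_cra ::
  "('q \<Rightarrow> 'r) \<Rightarrow> ('x \<Rightarrow> 'y) \<Rightarrow> ('q, 'x, 'a, 'm) cra \<Rightarrow> ('r, 'y, 'a, 'm) cra" where
  "map_cra f h C = \<lparr>cra_states = f ` cra_states C,
     cra_init = f (cra_init C),
     cra_registers = h ` cra_registers C,
     cra_delta = (\<lambda>q a. let (r, g) = cra_delta C (inv_into (cra_states C) f q) a
        in (f r, \<lambda>Y. let (X, \<alpha>) = g (inv_into (cra_registers C) h Y) in (h X, \<alpha>))),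
     cra_out = (\<lambda>(q, X, \<alpha>). (f q, h X, \<alpha>)) ` cra_out C\<rparr>"

lemma map_cra_simps:
  "cra_states (map_cra f h C) = f ` cra_states C"
  "cra_init (map_cra f h C) = f (cra_init C)"
  "cra_registers (map_cra f h C) = h ` cra_registers C"
  "cra_out (map_cra f h C) = (\<lambda>(q, X, \<alpha>). (f q, h X, \<alpha>)) ` cra_out C"
  by (simp_all add: map_cra_def)

lemma cra_delta_map_cra:
  "inj_on f (cra_states C) \<Longrightarrow> q \<in> cra_states C \<Longrightarrow> cra_delta (map_cra f h C) (f q) a =
    (f (fst (cra_delta C q a)),
     \<lambda>Y. map_prod h id (snd (cra_delta C q a) (inv_into (cra_registers C) h Y)))"
  by (auto simp: map_cra_def Let_def split: prod.splits)

lemma cra_run_states: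
  assumes "cost_register_automaton A C" "cra_run C w cs" "w \<in> lists A"
    "hd cs = (cra_init C, \<nu>)" "i \<le> length w"
  shows "fst (cs ! i) \<in> cra_states C"
  using assms(5)
proof (induction i)
  case 0
  have "cs \<noteq> []" using assms(2) by (auto simp: cra_run_def)
  then have "cs ! 0 = (cra_init C, \<nu>)" using assms(4) by (simp add: hd_conv_nth)
  then show ?case using assms(1) by (simp add: cost_register_automaton_def)
next
  case (Suc i)
  then have "cra_step C (cs ! i) (w ! i) (cs ! Suc i)" using assms(2) by (simp add: cra_run_def)
  then have "fst (cs ! Suc i) = fst (cra_delta C (fst (cs ! i)) (w ! i))"
    by (auto simp: cra_step_def)
  moreover have "w ! i \<in> A" using assms(3) Suc.prems by auto
  ultimately show ?case using assms(1) Suc by (simp add: cost_register_automaton_def)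
qed

lemma cra_step_map_cra:
  assumes C: "cost_register_automaton A C"
    and inj: "inj_on f (cra_states C)" "inj_on h (cra_registers C)"
    and "q \<in> cra_states C" "q' \<in> cra_states C" "a \<in> A"
    and \<nu>: "\<And>X. X \<in> cra_registers C \<Longrightarrow> \<nu>1 (h X) = \<nu> X"
    and \<nu>': "\<And>X. X \<in> cra_registers C \<Longrightarrow> \<nu>1' (h X) = \<nu>' X"
  shows "cra_step (map_cra f h C) (f q, \<nu>1) a (f q', \<nu>1') \<longleftrightarrow> cra_step C (q, \<nu>) a (q', \<nu>')"
proof -
  obtain r g where rg: "cra_delta C q a = (r, g)" by fastforce
  have r: "r \<in> cra_states C" and g: "\<And>Y. Y \<in> cra_registers C \<Longrightarrow> fst (g Y) \<in> cra_registers C"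
    using C assms(4,6) rg by (fastforce simp: cost_register_automaton_def)+
  have "f r = f q' \<longleftrightarrow> r = q'" using inj(1) r assms(5) by (auto dest: inj_onD)
  moreover have "(\<forall>Y\<in>cra_registers C. \<nu>1' (h Y) = \<nu>1 (h (fst (g Y))) * snd (g Y)) \<longleftrightarrow>
      (\<forall>Y\<in>cra_registers C. \<nu>' Y = \<nu> (fst (g Y)) * snd (g Y))"
    using \<nu> \<nu>' g by simp
  ultimately show ?thesis
    using inj(2)
    by (simp add: cra_step_def cra_delta_map_cra[OF inj(1) assms(4)] rg map_cra_simps
        map_prod_def split_beta prod_eq_iff)
qed

lemma cra_relation_map_cra:
  assumes C: "cost_register_automaton A C" and C': "cost_register_automaton A (map_cra f h C)"
    and inj: "inj_on f (cra_states C)" "inj_on h (cra_registers C)"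
  shows "cra_relation A (map_cra f h C) = cra_relation A C"
proof (intro set_eqI iffI)
  let ?C = "map_cra f h C"
  let ?f = "inv_into (cra_states C) f"
  fix x assume "x \<in> cra_relation A ?C"
  then obtain w \<nu> X' \<alpha> cs q' where x: "x = (w, \<nu> X' * \<alpha>)" "w \<in> lists A"
    and run: "cra_run ?C w cs" "hd cs = (cra_init ?C, \<lambda>_. 1)" "last cs = (q', \<nu>)"
      "(q', X', \<alpha>) \<in> cra_out ?C"
    unfolding cra_relation_def by blast
  obtain q X where q: "q' = f q" "X' = h X" "(q, X, \<alpha>) \<in> cra_out C"
    using run(4) by (auto simp: map_cra_simps)
  have qX: "q \<in> cra_states C" "X \<in> cra_registers C"
    using C q(3) by (auto simp: cost_register_automaton_def)
  define ds where "ds = map (\<lambda>(q, \<nu>). (?f q, \<lambda>X. \<nu> (h X))) cs"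
  have len: "length cs = Suc (length w)" using run(1) by (simp add: cra_run_def)
  have st: "fst (cs ! i) \<in> f ` cra_states C" if "i \<le> length w" for i
    using cra_run_states[OF C' run(1) x(2) run(2) that] by (simp add: map_cra_simps)
  have "cra_run C w ds"
    unfolding cra_run_def
  proof (intro conjI allI impI)
    show "length ds = Suc (length w)" using len by (simp add: ds_def)
    fix i assume i: "i < length w"
    let ?c = "cs ! i" and ?c' = "cs ! Suc i"
    have m: "?f (fst ?c) \<in> cra_states C" "?f (fst ?c') \<in> cra_states C"
      "f (?f (fst ?c)) = fst ?c" "f (?f (fst ?c')) = fst ?c'"
      using st[of i] st[of "Suc i"] i by (auto simp: inv_into_into f_inv_into_f)
    have wA: "w ! i \<in> A" using x(2) i by auto
    have "cra_step ?C (f (?f (fst ?c)), snd ?c) (w ! i) (f (?f (fst ?c')), snd ?c')"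
      using run(1) i m by (simp add: cra_run_def)
    then have "cra_step C (?f (fst ?c), \<lambda>X. snd ?c (h X)) (w ! i) (?f (fst ?c'), \<lambda>X. snd ?c' (h X))"
      by (subst (asm) cra_step_map_cra[OF C inj m(1) m(2) wA]) simp_all
    then show "cra_step C (ds ! i) (w ! i) (ds ! Suc i)"
      using i len by (simp add: ds_def split_beta)
  qed
  moreover have "cs \<noteq> []" using len by auto
  then have "hd ds = (cra_init C, \<lambda>_. 1)" "last ds = (q, \<lambda>X. \<nu> (h X))"
    using run(2,3) q qX C inj
    by (simp_all add: ds_def hd_map last_map map_cra_simps cost_register_automaton_def)
  ultimately show "x \<in> cra_relation A C"
    unfolding cra_relation_def using x q by (intro CollectI exI[of _ w] exI[of _ "\<lambda>X. \<nu> (h X)"]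
        exI[of _ X] exI[of _ \<alpha>] conjI exI[of _ ds] exI[of _ q]) simp_all
next
  let ?C = "map_cra f h C"
  let ?h = "inv_into (cra_registers C) h"
  fix x assume "x \<in> cra_relation A C"
  then obtain w \<nu> X \<alpha> cs q where x: "x = (w, \<nu> X * \<alpha>)" "w \<in> lists A"
    and run: "cra_run C w cs" "hd cs = (cra_init C, \<lambda>_. 1)" "last cs = (q, \<nu>)"
      "(q, X, \<alpha>) \<in> cra_out C"
    unfolding cra_relation_def by blast
  have qX: "q \<in> cra_states C" "X \<in> cra_registers C"
    using C run(4) by (auto simp: cost_register_automaton_def)
  define ds where "ds = map (\<lambda>(q, \<nu>). (f q, \<lambda>X. \<nu> (?h X))) cs"
  have len: "length cs = Suc (length w)" using run(1) by (simp add: cra_run_def)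
  have st: "fst (cs ! i) \<in> cra_states C" if "i \<le> length w" for i
    using cra_run_states[OF C run(1) x(2) run(2) that] .
  have "cra_run ?C w ds"
    unfolding cra_run_def
  proof (intro conjI allI impI)
    show "length ds = Suc (length w)" using len by (simp add: ds_def)
    fix i assume i: "i < length w"
    let ?c = "cs ! i" and ?c' = "cs ! Suc i"
    have m: "fst ?c \<in> cra_states C" "fst ?c' \<in> cra_states C"
      using st[of i] st[of "Suc i"] i by auto
    have wA: "w ! i \<in> A" using x(2) i by auto
    have "cra_step C (fst ?c, snd ?c) (w ! i) (fst ?c', snd ?c')"
      using run(1) i by (simp add: cra_run_def)
    then have "cra_step ?C (f (fst ?c), \<lambda>X. snd ?c (?h X)) (w ! i) (f (fst ?c'), \<lambda>X. snd ?c' (?h X))"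
      by (subst cra_step_map_cra[OF C inj m(1) m(2) wA, where \<nu> = "snd ?c" and \<nu>' = "snd ?c'"])
        (simp_all add: inj)
    then show "cra_step ?C (ds ! i) (w ! i) (ds ! Suc i)"
      using i len by (simp add: ds_def split_beta)
  qed
  moreover have "cs \<noteq> []" using len by auto
  then have "hd ds = (cra_init ?C, \<lambda>_. 1)" "last ds = (f q, \<lambda>X. \<nu> (?h X))"
    using run(2,3) by (simp_all add: ds_def hd_map last_map map_cra_simps)
  moreover have "(f q, h X, \<alpha>) \<in> cra_out ?C" using run(4) by (force simp: map_cra_simps)
  moreover have "\<nu> (?h (h X)) = \<nu> X" using qX inj by simp
  ultimately show "x \<in> cra_relation A ?C"
    unfolding cra_relation_def using x by (intro CollectI exI[of _ w] exI[of _ "\<lambda>X. \<nu> (?h X)"]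
        exI[of _ "h X"] exI[of _ \<alpha>] conjI exI[of _ ds] exI[of _ "f q"]) simp_all
qed

lemma independent_cra_relationI:
  fixes C :: "('q, 'x, 'a, 'm::monoid_mult) cra"
  assumes C: "cost_register_automaton A C" and ind: "independent_registers A C"
  shows "independent_cra_relation A (card (cra_registers C)) (cra_relation A C)"
proof -
  have fin: "finite (cra_states C)" "finite (cra_registers C)"
    using C by (auto simp: cost_register_automaton_def)
  obtain f :: "'q \<Rightarrow> nat" where f: "inj_on f (cra_states C)"
    using finite_imp_inj_to_nat_seg[OF fin(1)] by blast
  obtain h :: "'x \<Rightarrow> nat" where h: "inj_on h (cra_registers C)"
    using finite_imp_inj_to_nat_seg[OF fin(2)] by blast
  have C': "cost_register_automaton A (map_cra f h C)"
    unfolding cost_register_automaton_def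
  proof (intro conjI ballI)
    fix q' a assume "q' \<in> cra_states (map_cra f h C)" and a: "a \<in> A"
    then obtain q where q: "q \<in> cra_states C" "q' = f q" by (auto simp: map_cra_simps)
    show "fst (cra_delta (map_cra f h C) q' a) \<in> cra_states (map_cra f h C)"
      using C q a by (simp add: cra_delta_map_cra[OF f] map_cra_simps cost_register_automaton_def)
    have "fst (snd (cra_delta C q a) Y) \<in> cra_registers C" if "Y \<in> cra_registers C" for Y
      using C q a that by (fastforce simp: cost_register_automaton_def)
    then show "snd (cra_delta (map_cra f h C) q' a) ` cra_registers (map_cra f h C)
        \<subseteq> cra_registers (map_cra f h C) \<times> UNIV"
      using q h by (simp add: cra_delta_map_cra[OF f] map_cra_simps image_subset_iff mem_Times_iff)
  qed (use C in \<open>auto simp: cost_register_automaton_def map_cra_simps\<close>)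
  have "independent_registers A (map_cra f h C)"
    unfolding independent_registers_def
  proof (intro ballI allI impI)
    fix q' a Y' X' \<alpha>
    assume "q' \<in> cra_states (map_cra f h C)" and a: "a \<in> A"
      and "Y' \<in> cra_registers (map_cra f h C)"
      and e: "snd (cra_delta (map_cra f h C) q' a) Y' = (X', \<alpha>)"
    then obtain q Y where q: "q \<in> cra_states C" "q' = f q" "Y \<in> cra_registers C" "Y' = h Y"
      by (auto simp: map_cra_simps)
    have "fst (snd (cra_delta C q a) Y) = Y"
      using ind q a unfolding independent_registers_def by (metis prod.collapse)
    moreover have "X' = h (fst (snd (cra_delta C q a) Y))"
      using e q h by (auto simp: cra_delta_map_cra[OF f] map_prod_def split_beta)
    ultimately show "X' = Y'" using q by simp
  qed
  moreover have "card (cra_registers (map_cra f h C)) = card (cra_registers C)"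
    using h by (simp add: map_cra_simps card_image)
  ultimately show ?thesis
    unfolding independent_cra_relation_def using C' cra_relation_map_cra[OF C C' f h] by blast
qed

end

theory Submission
  imports Defs
begin

text \<open>
  A register that never reads another one just accumulates a product along the run, so it is a
  sequential automaton on the state space of the cost register automaton. Conversely, \<open>k\<close>
  sequential automata run in parallel on tuples of states, register \<open>i\<close> holding the weight
  read so far by the \<open>i\<close>-th one. Registers start at \<open>1\<close>, so the initial weights are
  multiplied in by the first transition or, on the empty word, by the output; a flag in the state
  tells whether this is still to be done.
\<close>

section \<open>Runs with independent registers\<close>

primrec cra_state :: "('q, 'x, 'a, 'm) cra \<Rightarrow> 'q \<Rightarrow> 'a list \<Rightarrow> 'q" where
  "cra_state C q [] = q"
| "cra_state C q (a # w) = cra_state C (fst (cra_delta C q a)) w"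

text \<open>The register that the update of \<open>X\<close> reads is ignored here. The result is
  therefore the factor by which a run multiplies \<open>X\<close> only when registers are
  independent.\<close>

primrec cra_weight :: "('q, 'x, 'a, 'm::monoid_mult) cra \<Rightarrow> 'x \<Rightarrow> 'q \<Rightarrow> 'a list \<Rightarrow> 'm" where
  "cra_weight C X q [] = 1"
| "cra_weight C X q (a # w) =
     snd (snd (cra_delta C q a) X) * cra_weight C X (fst (cra_delta C q a)) w"

text \<open>Keeping only the endpoints of a run lets runs be peeled off letter by letter, so later
  inductions go over the word and need no indexing into lists of configurations.\<close>

definition cra_reaches ::
  "('q, 'x, 'a, 'm::monoid_mult) cra \<Rightarrow> 'q \<times> ('x \<Rightarrow> 'm) \<Rightarrow> 'a list \<Rightarrow> 'q \<times> ('x \<Rightarrow> 'm) \<Rightarrow> bool" where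
  "cra_reaches C c w c' \<longleftrightarrow> (\<exists>cs. cra_run C w cs \<and> hd cs = c \<and> last cs = c')"

lemma cra_run_Nil: "cra_run C [] cs \<longleftrightarrow> (\<exists>c. cs = [c])"
  by (auto simp: cra_run_def length_Suc_conv)

lemma cra_run_Cons:
  "cra_run C (a # w) cs \<longleftrightarrow>
     (\<exists>c ds. cs = c # ds \<and> cra_step C c a (hd ds) \<and> cra_run C w ds)"
proof (cases cs)
  case Nil
  then show ?thesis by (simp add: cra_run_def)
next
  case (Cons c ds)
  then show ?thesis
    by (cases ds) (auto simp: cra_run_def All_less_Suc2)
qed

lemma cra_run_not_Nil: "cra_run C w cs \<Longrightarrow> cs \<noteq> []"
  by (auto simp: cra_run_def)

lemma cra_reaches_Nil: "cra_reaches C c [] c' \<longleftrightarrow> c' = c"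
  unfolding cra_reaches_def cra_run_Nil by (metis last.simps list.sel(1))

lemma cra_reaches_Cons:
  "cra_reaches C c (a # w) c' \<longleftrightarrow> (\<exists>d. cra_step C c a d \<and> cra_reaches C d w c')"
proof
  assume "cra_reaches C c (a # w) c'"
  then obtain ds where "cra_step C c a (hd ds)" "cra_run C w ds" "last (c # ds) = c'"
    unfolding cra_reaches_def cra_run_Cons by (metis list.sel(1))
  then show "\<exists>d. cra_step C c a d \<and> cra_reaches C d w c'"
    using cra_run_not_Nil unfolding cra_reaches_def by (metis last_ConsR)
next
  assume "\<exists>d. cra_step C c a d \<and> cra_reaches C d w c'"
  then obtain ds where "cra_step C c a (hd ds)" "cra_run C w ds" "last ds = c'"
    unfolding cra_reaches_def by metis
  then show "cra_reaches C c (a # w) c'"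
    unfolding cra_reaches_def cra_run_Cons
    by (intro exI[of _ "c # ds"]) (auto dest: cra_run_not_Nil)
qed

lemma cra_delta_closed:
  "cost_register_automaton A C \<Longrightarrow> q \<in> cra_states C \<Longrightarrow> a \<in> A
    \<Longrightarrow> fst (cra_delta C q a) \<in> cra_states C"
  by (simp add: cost_register_automaton_def)

lemma independent_registers_fst:
  "independent_registers A C \<Longrightarrow> q \<in> cra_states C \<Longrightarrow> a \<in> A \<Longrightarrow> Y \<in> cra_registers C
    \<Longrightarrow> fst (snd (cra_delta C q a) Y) = Y"
  unfolding independent_registers_def by (metis prod.collapse)

lemma cra_step_independent:
  assumes "independent_registers A C" "q \<in> cra_states C" "a \<in> A"
  shows "cra_step C (q, \<nu>) a (q', \<nu>') \<longleftrightarrow> q' = fst (cra_delta C q a) \<and>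
    (\<forall>Y\<in>cra_registers C. \<nu>' Y = \<nu> Y * snd (snd (cra_delta C q a) Y))"
  using independent_registers_fst[OF assms]
  by (cases "cra_delta C q a") (auto simp: cra_step_def split_beta prod_eq_iff)

text \<open>Each step multiplies a register on the right, so the factors accumulate in reading order
  and associativity gathers them. A step says nothing about the new valuation outside
  \<open>cra_registers C\<close>, hence the restriction to registers.\<close>

lemma cra_reachesD:
  assumes C: "cost_register_automaton A C" and ind: "independent_registers A C"
    and "q \<in> cra_states C" "w \<in> lists A" "cra_reaches C (q, \<nu>) w (q', \<nu>')"
  shows "q' = cra_state C q w \<and> (\<forall>X\<in>cra_registers C. \<nu>' X = \<nu> X * cra_weight C X q w)"
  using assms(3-)
proof (induction w arbitrary: q \<nu>)
  case Nil
  then show ?case by (simp add: cra_reaches_Nil)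
next
  case (Cons a w)
  from Cons.prems obtain r \<rho> where r: "cra_step C (q, \<nu>) a (r, \<rho>)"
    "cra_reaches C (r, \<rho>) w (q', \<nu>')"
    by (auto simp: cra_reaches_Cons)
  have a: "a \<in> A" "w \<in> lists A" using Cons.prems by auto
  note r1 = r(1)[unfolded cra_step_independent[OF ind Cons.prems(1) a(1)]]
  have "r \<in> cra_states C" using r1 cra_delta_closed[OF C Cons.prems(1) a(1)] by simp
  from Cons.IH[OF this a(2) r(2)] r1 show ?case by (simp add: mult.assoc)
qed

text \<open>Final valuations are not unique outside the registers, so existence is a separate claim.
  The witness applies the multiplication rule at every index, whether a register or not.\<close>

lemma cra_reaches_exists:
  assumes C: "cost_register_automaton A C" and ind: "independent_registers A C"
    and "q \<in> cra_states C" "w \<in> lists A"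
  shows "\<exists>\<nu>'. cra_reaches C (q, \<nu>) w (cra_state C q w, \<nu>')"
  using assms(3-)
proof (induction w arbitrary: q \<nu>)
  case Nil
  then show ?case by (simp add: cra_reaches_Nil)
next
  case (Cons a w)
  let ?r = "fst (cra_delta C q a)" and ?\<rho> = "\<lambda>Y. \<nu> Y * snd (snd (cra_delta C q a) Y)"
  have a: "a \<in> A" "w \<in> lists A" using Cons.prems by auto
  have "cra_step C (q, \<nu>) a (?r, ?\<rho>)"
    by (simp add: cra_step_independent[OF ind Cons.prems(1) a(1)])
  with Cons.IH[OF cra_delta_closed[OF C Cons.prems(1) a(1)] a(2), of ?\<rho>] show ?case
    by (auto simp: cra_reaches_Cons)
qed

lemma cra_relation_independent:
  assumes C: "cost_register_automaton A C" and ind: "independent_registers A C"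
  shows "cra_relation A C =
    {(w, cra_weight C X (cra_init C) w * \<alpha>) | w X \<alpha>.
       w \<in> lists A \<and> (cra_state C (cra_init C) w, X, \<alpha>) \<in> cra_out C}"
proof -
  have q0: "cra_init C \<in> cra_states C"
    and out: "\<And>q X \<alpha>. (q, X, \<alpha>) \<in> cra_out C \<Longrightarrow> X \<in> cra_registers C"
    using C by (auto simp: cost_register_automaton_def)
  have rel: "cra_relation A C = {(w, \<nu> X * \<alpha>) | w \<nu> X \<alpha>. w \<in> lists A \<and>
      (\<exists>q. cra_reaches C (cra_init C, \<lambda>_. 1) w (q, \<nu>) \<and> (q, X, \<alpha>) \<in> cra_out C)}"
    unfolding cra_relation_def cra_reaches_def by blast
  show ?thesis
  proof (intro set_eqI iffI)
    fix x assume "x \<in> cra_relation A C"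
    then obtain w \<nu> X \<alpha> q where x: "x = (w, \<nu> X * \<alpha>)" "w \<in> lists A"
      "cra_reaches C (cra_init C, \<lambda>_. 1) w (q, \<nu>)" "(q, X, \<alpha>) \<in> cra_out C"
      unfolding rel by blast
    from cra_reachesD[OF C ind q0 x(2,3)] x out[OF x(4)]
    show "x \<in> {(w, cra_weight C X (cra_init C) w * \<alpha>) | w X \<alpha>.
       w \<in> lists A \<and> (cra_state C (cra_init C) w, X, \<alpha>) \<in> cra_out C}" by auto
  next
    fix x assume "x \<in> {(w, cra_weight C X (cra_init C) w * \<alpha>) | w X \<alpha>.
       w \<in> lists A \<and> (cra_state C (cra_init C) w, X, \<alpha>) \<in> cra_out C}"
    then obtain w X \<alpha> where x: "x = (w, cra_weight C X (cra_init C) w * \<alpha>)" "w \<in> lists A"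
      "(cra_state C (cra_init C) w, X, \<alpha>) \<in> cra_out C" by blast
    from cra_reaches_exists[OF C ind q0 x(2)] obtain \<nu>
      where r: "cra_reaches C (cra_init C, \<lambda>_. 1) w (cra_state C (cra_init C) w, \<nu>)" by blast
    from cra_reachesD[OF C ind q0 x(2) r] out[OF x(3)] x(1) have "x = (w, \<nu> X * \<alpha>)" by simp
    with x r show "x \<in> cra_relation A C" unfolding rel by blast
  qed
qed

section \<open>Disjoint unions of weighted automata\<close>

lemma sequential_imp_weighted_automaton: "sequential_wa A W \<Longrightarrow> weighted_automaton A W"
  by (simp add: sequential_wa_def)

text \<open>Each transition of a component stays among its states, and a state lies in at most one
  component. A run of the union is thus confined to the component in which it starts.\<close>

lemma wa_relation_disjoint_union:
  assumes wa: "\<And>i. i < k \<Longrightarrow> weighted_automaton A (Ws i)" and d: "wa_disjoint_union k Ws W"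
  shows "wa_relation W = (\<Union>i<k. wa_relation (Ws i))"
proof -
  have part: "j = i" if "i < k" "j < k" "p \<in> wa_states (Ws i)" "p \<in> wa_states (Ws j)" for i j p
  proof (rule ccontr)
    assume "j \<noteq> i"
    then have "wa_states (Ws i) \<inter> wa_states (Ws j) = {}"
      using d that(1,2) by (simp add: wa_disjoint_union_def)
    then show False using that(3,4) by blast
  qed
  have W: "wa_states W = (\<Union>i<k. wa_states (Ws i))" "wa_init W = (\<Union>i<k. wa_init (Ws i))"
     "wa_final W = (\<Union>i<k. wa_final (Ws i))" "wa_trans W = (\<Union>i<k. wa_trans (Ws i))"
    using d by (simp_all add: wa_disjoint_union_def)
  have st: "p \<in> wa_states (Ws i) \<and> r \<in> wa_states (Ws i)"
    if "i < k" "(p, a, \<alpha>, r) \<in> wa_trans (Ws i)" for i p a \<alpha> r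
    using wa[OF that(1)] that(2) by (auto simp: weighted_automaton_def)
  have up: "wa_run W p w \<beta> q" if "wa_run (Ws i) p w \<beta> q" "i < k" for i p w \<beta> q
    using that by (induction rule: wa_run.induct) (auto intro!: wa_run.intros simp: W)
  have down: "wa_run (Ws i) p w \<beta> q \<and> q \<in> wa_states (Ws i)"
    if "wa_run W p w \<beta> q" "i < k" "p \<in> wa_states (Ws i)" for i p w \<beta> q
    using that
  proof (induction rule: wa_run.induct)
    case (wa_run_Nil p)
    then show ?case by (auto intro: wa_run.intros)
  next
    case (wa_run_Cons p a \<alpha> r w \<beta> q)
    from wa_run_Cons(1) obtain j where j: "j < k" "(p, a, \<alpha>, r) \<in> wa_trans (Ws j)"
      by (auto simp: W)
    with st part wa_run_Cons.prems have "j = i" by blast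
    with j st wa_run_Cons show ?case by (auto intro: wa_run.intros)
  qed
  show ?thesis
  proof (intro set_eqI iffI)
    fix x assume "x \<in> wa_relation W"
    then obtain w \<alpha> \<beta> \<gamma> p q where x: "x = (w, \<alpha> * \<beta> * \<gamma>)"
      and h: "(p, \<alpha>) \<in> wa_init W" "wa_run W p w \<beta> q" "(q, \<gamma>) \<in> wa_final W"
      unfolding wa_relation_def by blast
    from h(1) obtain i where i: "i < k" "(p, \<alpha>) \<in> wa_init (Ws i)" by (auto simp: W)
    from h(3) obtain j where j: "j < k" "(q, \<gamma>) \<in> wa_final (Ws j)" by (auto simp: W)
    have "p \<in> wa_states (Ws i)" "q \<in> wa_states (Ws j)"
      using wa[OF i(1)] i(2) wa[OF j(1)] j(2) by (auto simp: weighted_automaton_def)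
    \<comment> \<open>The state \<open>q\<close> lies in both component \<open>i\<close> and
      component \<open>j\<close>, so the two indices agree.\<close>
    with down[OF h(2) i(1)] part i j have "wa_run (Ws i) p w \<beta> q" "(q, \<gamma>) \<in> wa_final (Ws i)"
      by auto
    with i x show "x \<in> (\<Union>i<k. wa_relation (Ws i))" by (auto intro: wa_relationI)
  next
    fix x assume "x \<in> (\<Union>i<k. wa_relation (Ws i))"
    then obtain i w \<alpha> \<beta> \<gamma> p q where i: "i < k" and x: "x = (w, \<alpha> * \<beta> * \<gamma>)"
      and h: "(p, \<alpha>) \<in> wa_init (Ws i)" "wa_run (Ws i) p w \<beta> q" "(q, \<gamma>) \<in> wa_final (Ws i)"
      unfolding wa_relation_def by blast
    then show "x \<in> wa_relation W" using up[OF h(2) i] by (auto intro!: wa_relationI simp: W)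
  qed
qed

section \<open>From independent registers to sequential automata\<close>

text \<open>The tag \<open>X\<close> on states makes the automata of different registers disjoint.
  The initial weight 1 mirrors the initial valuation.\<close>

definition register_wa ::
  "'a set \<Rightarrow> ('q, 'x, 'a, 'm::monoid_mult) cra \<Rightarrow> 'x \<Rightarrow> ('q \<times> 'x, 'a, 'm) wa" where
  "register_wa A C X = \<lparr>wa_states = cra_states C \<times> {X},
     wa_init = {((cra_init C, X), 1)},
     wa_final = {((q, X), \<alpha>) | q \<alpha>. (q, X, \<alpha>) \<in> cra_out C},
     wa_trans = (\<lambda>(q, a). ((q, X), a, snd (snd (cra_delta C q a) X), (fst (cra_delta C q a), X)))
       ` (cra_states C \<times> A)\<rparr>"

lemma sequential_register_wa:
  assumes "finite A" and C: "cost_register_automaton A C"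
  shows "sequential_wa A (register_wa A C X)"
proof -
  have "wa_final (register_wa A C X) \<subseteq> (\<lambda>(q, Y, \<alpha>). ((q, Y), \<alpha>)) ` cra_out C"
    by (force simp: register_wa_def)
  then have "finite (wa_final (register_wa A C X))"
    using C finite_surj by (auto simp: cost_register_automaton_def)
  with assms show ?thesis
    by (auto simp: sequential_wa_def weighted_automaton_def register_wa_def
        cost_register_automaton_def)
qed

lemma wa_trans_register_wa:
  "((q, X), a, \<alpha>, p) \<in> wa_trans (register_wa A C X) \<longleftrightarrow> q \<in> cra_states C \<and> a \<in> A \<and>
    \<alpha> = snd (snd (cra_delta C q a) X) \<and> p = (fst (cra_delta C q a), X)"
  by (auto simp: register_wa_def)

text \<open>From every state of \<open>C\<close> there is exactly one transition per letter of
  \<open>A\<close>, so a word over \<open>A\<close> has exactly one run, and any other word has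
  none.\<close>

lemma wa_run_register_wa:
  assumes C: "cost_register_automaton A C"
  shows "q \<in> cra_states C \<Longrightarrow> wa_run (register_wa A C X) (q, X) w \<beta> p \<longleftrightarrow>
    w \<in> lists A \<and> \<beta> = cra_weight C X q w \<and> p = (cra_state C q w, X)"
proof (induction w arbitrary: q \<beta>)
  case Nil
  then show ?case by (subst wa_run.simps) (auto simp: register_wa_def)
next
  case (Cons a w)
  have step: "wa_run (register_wa A C X) (q, X) (a # w) \<beta> p \<longleftrightarrow> a \<in> A \<and>
      (\<exists>\<beta>'. \<beta> = snd (snd (cra_delta C q a) X) * \<beta>' \<and>
        wa_run (register_wa A C X) (fst (cra_delta C q a), X) w \<beta>' p)"
    using Cons.prems by (subst wa_run.simps) (auto simp: wa_trans_register_wa)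
  show ?case
  proof (cases "a \<in> A")
    case True
    show ?thesis
      unfolding step Cons.IH[OF cra_delta_closed[OF C Cons.prems True]] by (auto simp: True)
  qed (simp add: step)
qed

lemma wa_relation_register_wa:
  assumes "cost_register_automaton A C"
  shows "wa_relation (register_wa A C X) =
    {(w, cra_weight C X (cra_init C) w * \<alpha>) | w \<alpha>.
       w \<in> lists A \<and> (cra_state C (cra_init C) w, X, \<alpha>) \<in> cra_out C}"
proof -
  have "cra_init C \<in> cra_states C" using assms by (simp add: cost_register_automaton_def)
  from wa_run_register_wa[OF assms this, of X] show ?thesis
    unfolding wa_relation_def by (auto simp: register_wa_def)
qed

lemma independent_imp_k_sequential:
  assumes "finite A" and "independent_cra_relation A k R"
  shows "k_sequential_relation A k R"
proof -
  obtain C :: "(nat, nat, 'a, 'b) cra" where C: "cost_register_automaton A C"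
    and ind: "independent_registers A C" and k: "card (cra_registers C) = k"
    and R: "cra_relation A C = R"
    using assms(2) by (auto simp: independent_cra_relation_def)
  have "finite (cra_registers C)" using C by (simp add: cost_register_automaton_def)
  then obtain e where e: "bij_betw e {..<k} (cra_registers C)"
    using ex_bij_betw_nat_finite k by (metis atLeast0LessThan)
  define Ws where "Ws = (\<lambda>i. register_wa A C (e i))"
  define W where "W = \<lparr>wa_states = (\<Union>i<k. wa_states (Ws i)), wa_init = (\<Union>i<k. wa_init (Ws i)),
    wa_final = (\<Union>i<k. wa_final (Ws i)), wa_trans = (\<Union>i<k. wa_trans (Ws i))\<rparr>"
  have seq: "sequential_wa A (Ws i)" for i
    using sequential_register_wa[OF assms(1) C] by (simp add: Ws_def)
  \<comment> \<open>Injectivity of the enumeration \<open>e\<close> gives distinct indices distinct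
    tags, hence disjoint state sets.\<close>
  have d: "wa_disjoint_union k Ws W"
    using bij_betw_imp_inj_on[OF e]
    by (auto simp: wa_disjoint_union_def W_def Ws_def register_wa_def inj_on_def)
  have "wa_relation W = (\<Union>i<k. wa_relation (Ws i))"
    using sequential_imp_weighted_automaton[OF seq] d by (rule wa_relation_disjoint_union)
  also have "\<dots> = (\<Union>X\<in>cra_registers C. wa_relation (register_wa A C X))"
    unfolding bij_betw_imp_surj_on[OF e, symmetric] by (simp add: Ws_def)
  \<comment> \<open>Every output triple of \<open>C\<close> mentions a register of \<open>C\<close>,
    so the union over the registers misses no output.\<close>
  also have "\<dots> = R"
    using C unfolding R[symmetric] cra_relation_independent[OF C ind] wa_relation_register_wa[OF C]
    by (fastforce simp: cost_register_automaton_def)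
  finally have "wa_relation W = R" .
  moreover have "k_sequential_wa A k W"
    using seq d by (auto simp: k_sequential_wa_def)
  ultimately show ?thesis using k_sequential_relationI by blast
qed

section \<open>From sequential automata to independent registers\<close>

text \<open>Determinism of a sequential automaton makes the description well defined;
  \<open>None\<close> means that the run dies.\<close>

definition wa_next :: "('q, 'a, 'm) wa \<Rightarrow> 'q \<Rightarrow> 'a \<Rightarrow> ('m \<times> 'q) option" where
  "wa_next W p a =
     (if \<exists>t. (p, a, t) \<in> wa_trans W then Some (THE t. (p, a, t) \<in> wa_trans W) else None)"

lemma wa_next_eq_Some:
  assumes "sequential_wa A W"
  shows "wa_next W p a = Some t \<longleftrightarrow> (p, a, t) \<in> wa_trans W"
proof -
  have "t = t'" if "(p, a, t) \<in> wa_trans W" "(p, a, t') \<in> wa_trans W" for t t'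
    using assms that unfolding sequential_wa_def by (metis prod.collapse)
  then have "(THE t. (p, a, t) \<in> wa_trans W) = t" if "(p, a, t) \<in> wa_trans W" for t
    using that by blast
  then show ?thesis unfolding wa_next_def by (metis option.distinct(1) option.inject)
qed

text \<open>
  The partial map in a state gives the current state of each automaton whose run has not died.
  The flag is true in the initial state only.
\<close>

definition product_states :: "nat \<Rightarrow> (nat \<Rightarrow> ('q, 'a, 'm) wa) \<Rightarrow> (bool \<times> (nat \<rightharpoonup> 'q)) set" where
  "product_states k Ws =
     UNIV \<times> {m. dom m \<subseteq> {..<k} \<and> (\<forall>i p. m i = Some p \<longrightarrow> p \<in> wa_states (Ws i))}"

definition pending_weight :: "(nat \<Rightarrow> 'm::monoid_mult) \<Rightarrow> bool \<Rightarrow> nat \<Rightarrow> 'm" where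
  "pending_weight \<iota> b i = (if b then \<iota> i else 1)"

text \<open>The arguments \<open>s\<close> and \<open>\<iota>\<close> supply initial states and
  initial weights. Pending weights stand on the left, since the initial weight comes first and the
  monoid need not commute. The factor 1 for a dead component is a mere default: outputs are taken
  only from indices with \<open>m i = Some q\<close>.\<close>

definition product_cra ::
  "nat \<Rightarrow> (nat \<Rightarrow> ('q, 'a, 'm::monoid_mult) wa) \<Rightarrow> (nat \<Rightarrow> 'q) \<Rightarrow> (nat \<Rightarrow> 'm)
     \<Rightarrow> (bool \<times> (nat \<rightharpoonup> 'q), nat, 'a, 'm) cra" where
  "product_cra k Ws s \<iota> = \<lparr>cra_states = product_states k Ws,
     cra_init = (True, \<lambda>i. if i < k then Some (s i) else None),
     cra_registers = {..<k},
     cra_delta = (\<lambda>(b, m) a. let n = (\<lambda>i. Option.bind (m i) (\<lambda>p. wa_next (Ws i) p a)) in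
       ((False, \<lambda>i. map_option snd (n i)),
        \<lambda>i. (i, pending_weight \<iota> b i * (case n i of None \<Rightarrow> 1 | Some (\<alpha>, _) \<Rightarrow> \<alpha>)))),
     cra_out = {((b, m), i, pending_weight \<iota> b i * \<gamma>) | b m i q \<gamma>.
       (b, m) \<in> product_states k Ws \<and> i < k \<and> m i = Some q \<and> (q, \<gamma>) \<in> wa_final (Ws i)}\<rparr>"

lemma product_cra_delta:
  "fst (cra_delta (product_cra k Ws s \<iota>) (b, m) a) =
     (False, \<lambda>i. map_option snd (Option.bind (m i) (\<lambda>p. wa_next (Ws i) p a)))"
  "m i = Some p \<Longrightarrow> wa_next (Ws i) p a = Some (\<alpha>, r) \<Longrightarrow>
     snd (snd (cra_delta (product_cra k Ws s \<iota>) (b, m) a) i) = pending_weight \<iota> b i * \<alpha>"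
  by (simp_all add: product_cra_def Let_def)

section \<open>Well-formedness and correctness of the product automaton\<close>

lemma finite_product_states:
  assumes "\<And>i. i < k \<Longrightarrow> finite (wa_states (Ws i))"
  shows "finite (product_states k Ws)"
proof -
  let ?Q = "\<Union>i<k. wa_states (Ws i)"
  \<comment> \<open>Partial maps are sorted by their domain: there are finitely many domains, and
    for each one finitely many maps into the finite union of the state sets.\<close>
  have "{m. dom m \<subseteq> {..<k} \<and> (\<forall>i p. m i = Some p \<longrightarrow> p \<in> wa_states (Ws i))}
      \<subseteq> (\<Union>D\<in>Pow {..<k}. {m. dom m = D \<and> ran m \<subseteq> ?Q})"
    by (fastforce simp: ran_def)
  moreover have "finite (\<Union>D\<in>Pow {..<k}. {m. dom m = D \<and> ran m \<subseteq> ?Q})"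
    using assms by (intro finite_UN_I finite_set_of_finite_maps) (auto intro: finite_subset)
  ultimately have "finite {m. dom m \<subseteq> {..<k} \<and> (\<forall>i p. m i = Some p \<longrightarrow> p \<in> wa_states (Ws i))}"
    by (rule finite_subset)
  then show ?thesis by (simp add: product_states_def)
qed

lemma cost_register_automaton_product_cra:
  assumes seq: "\<And>i. i < k \<Longrightarrow> sequential_wa A (Ws i)"
    and s: "\<And>i. i < k \<Longrightarrow> s i \<in> wa_states (Ws i)"
  shows "cost_register_automaton A (product_cra k Ws s \<iota>)"
proof -
  have wa: "weighted_automaton A (Ws i)" if "i < k" for i
    using seq[OF that] by (simp add: sequential_wa_def)
  then have finQ: "finite (product_states k Ws)"
    by (intro finite_product_states) (simp add: weighted_automaton_def)
  \<comment> \<open>Finiteness of the output relation: each output arises from a product state, an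
    index and a final pair of that component.\<close>
  have "cra_out (product_cra k Ws s \<iota>) \<subseteq>
      (\<lambda>((b, m), i, q, \<gamma>). ((b, m), i, pending_weight \<iota> b i * \<gamma>)) `
        (product_states k Ws \<times> Sigma {..<k} (\<lambda>i. wa_final (Ws i)))"
    by (force simp: product_cra_def)
  moreover have "finite (product_states k Ws \<times> Sigma {..<k} (\<lambda>i. wa_final (Ws i)))"
    using finQ wa by (intro finite_cartesian_product finite_SigmaI)
      (auto simp: weighted_automaton_def)
  ultimately have out: "finite (cra_out (product_cra k Ws s \<iota>))"
    using finite_surj by blast
  have nxt: "r \<in> wa_states (Ws i)" if "i < k" "wa_next (Ws i) p a = Some (\<alpha>, r)" for i p a \<alpha> r
    using that wa[OF that(1)] by (auto simp: wa_next_eq_Some[OF seq] weighted_automaton_def)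
  have "fst (cra_delta (product_cra k Ws s \<iota>) (b, m) a) \<in> product_states k Ws"
    if "(b, m) \<in> product_states k Ws" for b m a
  proof -
    have dom: "i < k" if "m i = Some p" for i p
      using \<open>(b, m) \<in> product_states k Ws\<close> that by (auto simp: product_states_def)
    show ?thesis
      unfolding product_cra_delta product_states_def
      by (auto simp: bind_eq_Some_conv dest: dom intro: nxt)
  qed
  then show ?thesis
    using finQ out s unfolding cost_register_automaton_def
    by (auto simp: product_cra_def Let_def)
      (auto simp: product_states_def dom_def split: if_splits)
qed

lemma independent_registers_product_cra: "independent_registers A (product_cra k Ws s \<iota>)"
  by (auto simp: independent_registers_def product_cra_def Let_def)

text \<open>The pending weights on both sides make the invariant hold on the empty word as well.\<close>

lemma wa_run_product_cra:
  fixes Ws :: "nat \<Rightarrow> ('q, 'a, 'm::monoid_mult) wa" and k s \<iota>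
  assumes seq: "sequential_wa A (Ws i)"
  defines "C \<equiv> product_cra k Ws s \<iota>"
  shows "wa_run (Ws i) p w \<beta> q \<Longrightarrow> m i = Some p \<Longrightarrow>
    snd (cra_state C (b, m) w) i = Some q \<and>
    cra_weight C i (b, m) w * pending_weight \<iota> (fst (cra_state C (b, m) w)) i =
      pending_weight \<iota> b i * \<beta>"
proof (induction arbitrary: b m rule: wa_run.induct)
  case (wa_run_Nil p)
  then show ?case by simp
next
  case (wa_run_Cons p a \<alpha> r w \<beta> q)
  let ?m = "\<lambda>i. map_option snd (Option.bind (m i) (\<lambda>p. wa_next (Ws i) p a))"
  have n: "wa_next (Ws i) p a = Some (\<alpha>, r)"
    using wa_run_Cons.hyps(1) by (simp add: wa_next_eq_Some[OF seq])
  note C = product_cra_delta(1)[of k Ws s \<iota> b m a, folded C_def]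
    product_cra_delta(2)[of m i p Ws a \<alpha> r k s \<iota> b, folded C_def, OF wa_run_Cons.prems n]
  have "?m i = Some r" using wa_run_Cons.prems n by simp
  \<comment> \<open>The first letter multiplies in the pending weight of \<open>b\<close> followed
    by \<open>\<alpha>\<close> and clears the flag. The right-hand side of the induction hypothesis
    is then just \<open>\<beta>\<close>.\<close>
  from wa_run_Cons.IH[where m = ?m and b = False, OF this] C show ?case
    by (simp add: mult.assoc) (simp add: pending_weight_def)
qed

text \<open>A dead component never revives, so one that is alive after \<open>w\<close> has a
  transition at every letter; these form the run and show that \<open>w\<close> is over
  \<open>A\<close>. No weight is claimed: it follows by feeding the run to
  \<open>wa_run_product_cra\<close>.\<close>

lemma product_cra_wa_run:
  fixes Ws :: "nat \<Rightarrow> ('q, 'a, 'm::monoid_mult) wa" and k s \<iota>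
  assumes seq: "sequential_wa A (Ws i)"
  defines "C \<equiv> product_cra k Ws s \<iota>"
  assumes "snd (cra_state C (b, m) w) i = Some q"
    "\<And>p. m i = Some p \<Longrightarrow> p \<in> wa_states (Ws i)"
  shows "w \<in> lists A \<and> (\<exists>p \<beta>. m i = Some p \<and> wa_run (Ws i) p w \<beta> q)"
  using assms(3-)
proof (induction w arbitrary: b m)
  case Nil
  then show ?case by (auto intro: wa_run.intros)
next
  case (Cons a w)
  let ?m = "\<lambda>i. map_option snd (Option.bind (m i) (\<lambda>p. wa_next (Ws i) p a))"
  have tr: "a \<in> A \<and> r \<in> wa_states (Ws i)" if "(p, a, \<alpha>, r) \<in> wa_trans (Ws i)" for p \<alpha> r
    using seq that by (auto simp: sequential_wa_def weighted_automaton_def)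
  have "snd (cra_state C (False, ?m) w) i = Some q"
    using Cons.prems(1) product_cra_delta(1)[of k Ws s \<iota> b m a] by (simp add: C_def)
  moreover have "r \<in> wa_states (Ws i)" if "?m i = Some r" for r
    using that tr by (auto simp: bind_eq_Some_conv wa_next_eq_Some[OF seq])
  ultimately have "w \<in> lists A \<and> (\<exists>r \<beta>. ?m i = Some r \<and> wa_run (Ws i) r w \<beta> q)"
    by (rule Cons.IH)
  then show ?case using tr
    by (fastforce simp: bind_eq_Some_conv wa_next_eq_Some[OF seq] intro: wa_run.intros)
qed

lemma cra_relation_product_cra:
  assumes seq: "\<And>i. i < k \<Longrightarrow> sequential_wa A (Ws i)"
    and init: "\<And>i. i < k \<Longrightarrow> wa_init (Ws i) = {(s i, \<iota> i)}"
  shows "cra_relation A (product_cra k Ws s \<iota>) = (\<Union>i<k. wa_relation (Ws i))"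
proof -
  let ?C = "product_cra k Ws s \<iota>"
  let ?m = "\<lambda>i. if i < k then Some (s i) else None"
  have s: "s i \<in> wa_states (Ws i)" if "i < k" for i
    using seq[OF that] init[OF that] by (auto simp: sequential_wa_def weighted_automaton_def)
  have C: "cost_register_automaton A ?C" by (rule cost_register_automaton_product_cra[OF seq s])
  have c0: "cra_init ?C = (True, ?m)" by (simp add: product_cra_def)
  note rel = cra_relation_independent[OF C independent_registers_product_cra, unfolded c0]
  show ?thesis
  proof (intro set_eqI iffI)
    fix x assume "x \<in> cra_relation A ?C"
    then obtain w i \<alpha> where x: "x = (w, cra_weight ?C i (True, ?m) w * \<alpha>)" "w \<in> lists A"
      "(cra_state ?C (True, ?m) w, i, \<alpha>) \<in> cra_out ?C"
      unfolding rel by blast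
    obtain b m where bm: "cra_state ?C (True, ?m) w = (b, m)" by fastforce
    from x(3) bm obtain q \<gamma> where q: "i < k" "m i = Some q" "(q, \<gamma>) \<in> wa_final (Ws i)"
      "\<alpha> = pending_weight \<iota> b i * \<gamma>"
      by (auto simp: product_cra_def)
    obtain \<beta> where run: "wa_run (Ws i) (s i) w \<beta> q"
      using product_cra_wa_run[where m = ?m and Ws = Ws, OF seq[OF q(1)], of k s \<iota> True w q] bm q s
      by auto
    \<comment> \<open>The flag is true at the start, so the pending weight on the right-hand side is
      \<open>\<iota> i\<close>.\<close>
    from wa_run_product_cra[where Ws = Ws and m = ?m, OF seq[OF q(1)] run, of k s \<iota> True] bm q
    have "cra_weight ?C i (True, ?m) w * pending_weight \<iota> b i = \<iota> i * \<beta>"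
      by (simp add: pending_weight_def)
    then have "x = (w, \<iota> i * \<beta> * \<gamma>)" using x q by (simp add: mult.assoc[symmetric])
    with run q init[OF q(1)] show "x \<in> (\<Union>i<k. wa_relation (Ws i))"
      by (auto intro!: wa_relationI)
  next
    fix x assume "x \<in> (\<Union>i<k. wa_relation (Ws i))"
    then obtain i w \<beta> \<gamma> q where i: "i < k" and x: "x = (w, \<iota> i * \<beta> * \<gamma>)"
      and run: "wa_run (Ws i) (s i) w \<beta> q" and q: "(q, \<gamma>) \<in> wa_final (Ws i)"
      using init unfolding wa_relation_def by auto
    obtain b m where bm: "cra_state ?C (True, ?m) w = (b, m)" by fastforce
    from wa_run_product_cra[where Ws = Ws and m = ?m, OF seq[OF i] run, of k s \<iota> True] bm i
    have m: "m i = Some q"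
      and wt: "cra_weight ?C i (True, ?m) w * pending_weight \<iota> b i = \<iota> i * \<beta>"
      by (simp_all add: pending_weight_def)
    have w: "w \<in> lists A"
      using product_cra_wa_run[where m = ?m and Ws = Ws, OF seq[OF i], of k s \<iota> True w q] bm m s i
      by auto
    \<comment> \<open>Outputs are attached only to members of \<open>product_states\<close>, so the
      state reached has to be shown to be one.\<close>
    have "cra_state ?C c v \<in> product_states k Ws"
      if "c \<in> product_states k Ws" "v \<in> lists A" for c v
      using that
    proof (induction v arbitrary: c)
      case (Cons a v)
      then show ?case using cra_delta_closed[OF C, of c a] by (simp add: product_cra_def)
    qed simp
    moreover have "(True, ?m) \<in> product_states k Ws"
      using C c0 by (auto simp: cost_register_automaton_def product_cra_def)
    ultimately have "(b, m) \<in> product_states k Ws" using bm w by metis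
    with i m q have "((b, m), i, pending_weight \<iota> b i * \<gamma>) \<in> cra_out ?C"
      by (auto simp: product_cra_def)
    moreover have "x = (w, cra_weight ?C i (True, ?m) w * (pending_weight \<iota> b i * \<gamma>))"
      using x wt by (simp add: mult.assoc[symmetric])
    ultimately show "x \<in> cra_relation A ?C" unfolding rel using w bm by auto
  qed
qed

section \<open>From the product automaton to the equivalence\<close>

lemma k_sequential_imp_independent:
  assumes "k_sequential_relation A k R"
  shows "independent_cra_relation A k R"
proof -
  obtain W :: "(nat, 'a, 'b) wa" and Ws where seq: "\<And>i. i < k \<Longrightarrow> sequential_wa A (Ws i)"
    and d: "wa_disjoint_union k Ws W" and R: "wa_relation W = R"
    using assms by (auto simp: k_sequential_relation_def k_sequential_wa_def)
  \<comment> \<open>With the bound on \<open>i\<close> inside the existential, choice yields one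
    total function \<open>c\<close> of initial pairs.\<close>
  have "\<forall>i. \<exists>p. i < k \<longrightarrow> wa_init (Ws i) = {p}"
    using seq by (auto simp: sequential_wa_def card_1_singleton_iff)
  then obtain c where "\<And>i. i < k \<Longrightarrow> wa_init (Ws i) = {c i}" by metis
  then have init: "wa_init (Ws i) = {((fst \<circ> c) i, (snd \<circ> c) i)}" if "i < k" for i
    using that by simp
  let ?C = "product_cra k Ws (fst \<circ> c) (snd \<circ> c)"
  have "(fst \<circ> c) i \<in> wa_states (Ws i)" if "i < k" for i
    using seq[OF that] init[OF that] by (auto simp: sequential_wa_def weighted_automaton_def)
  with seq have "cost_register_automaton A ?C"
    by (rule cost_register_automaton_product_cra)
  then have "independent_cra_relation A (card (cra_registers ?C)) (cra_relation A ?C)"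
    using independent_registers_product_cra by (rule independent_cra_relationI)
  moreover have "cra_relation A ?C = (\<Union>i<k. wa_relation (Ws i))"
    using seq init by (rule cra_relation_product_cra)
  moreover have "R = (\<Union>i<k. wa_relation (Ws i))"
    using sequential_imp_weighted_automaton[OF seq] d unfolding R[symmetric]
    by (rule wa_relation_disjoint_union)
  ultimately show ?thesis by (simp add: product_cra_def)
qed

theorem proposition4:
  fixes A :: "'a set" and k :: nat and R :: "('a list \<times> 'm::monoid_mult) set"
  assumes "finite A" and "k > 0" and "R \<subseteq> lists A \<times> UNIV"
  shows "k_sequential_relation A k R \<longleftrightarrow> independent_cra_relation A k R"
  using k_sequential_imp_independent independent_imp_k_sequential[OF assms(1)] by blast

end
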